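(* Let $N$ be prime and let $k$ be a positive integer with $2k+1<N$. Then $(2k+1)\min(4k^2-2k+1,N)$ measurements from a Gabor frame generated by a generic window $g$ of length $k+1$ do $Fk$-sparse phase retrieval. Precisely: for generic $g\in\mathbb{C}^N$ with support contained in $\{0,1,\dots,k\}\subseteq\mathbb{Z}_N$, and for any $A,B\subseteq\mathbb{Z}_N$ with $|A|=\min(4k^2-2k+1,N)$ and $|B|=2k+1$, the set $\{g_\lambda:\lambda\in A\times B\}$ allows $Fk$-sparse phase retrieval.
   Context: Vectors in $\mathbb{C}^N$ are indexed by $\mathbb{Z}_N=\mathbb{Z}/N\mathbb{Z}$; $\omega=e^{2\pi i/N}$. $\|f\|_0$ is the number of non-zero entries of $f$. The scalar product is $\langle x,y\rangle=\sum_{j\in\mathbb{Z}_N}\overline{x(j)}\,y(j)$. Translations and modulations are $(T_px)(n)=x(n-p)$ and $(M_\ell x)(n)=\omega^{\ell n}x(n)$. For $\lambda=(p,\ell)\in\mathbb{Z}_N^2$ put $g_\lambda=M_\ell T_pg$ (so in $A\times B$, the set $A$ contains translation parameters and $B$ modulation parameters). The Fourier basis $F$ is the $N\times N$ discrete Fourier matrix, normalized to be unitary, $F_{jn}=N^{-1/2}\omega^{-jn}$; a signal $x$ is $Fk$-sparse if $x=Fz$ for some $z\in\mathbb{C}^N$ with $\|z\|_0\le k$. With $\mathbb{T}=\{c\in\mathbb{C}:|c|=1\}$, a system $(g_\lambda)_{\lambda\in\Lambda}$ allows $Fk$-sparse phase retrieval if, whenever $x,y$ are $Fk$-sparse and satisfy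 $|\langle x,g_\lambda\rangle|=|\langle y,g_\lambda\rangle|$ for all $\lambda\in\Lambda$, there is $c\in\mathbb{T}$ with $x=cy$. "For generic $g$ supported in $\{0,\dots,k\}$" means: there is a not identically zero real polynomial $P$ in the $2(k+1)$ real variables $\mathrm{Re}\,g(0),\mathrm{Im}\,g(0),\dots,\mathrm{Re}\,g(k),\mathrm{Im}\,g(k)$ such that the assertion holds for every such $g$ with $P(g)\neq0$. *)

theory Defs
  imports Complex_Main "HOL-Library.Poly_Mapping" "Berlekamp_Zassenhaus.Finite_Field"
begin

text \<open>
  With \<open>N = CARD('p)\<close>, the type \<open>'p mod_ring\<close> is the ring of integers modulo \<open>N\<close>, and
  \<open>to_int_mod_ring\<close> picks the representative in \<open>{0..<N}\<close>.  A vector in \<open>N\<close>-dimensional complex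
  space is a function on \<open>'p mod_ring\<close>.
\<close>

type_synonym 'p signal = "'p mod_ring \<Rightarrow> complex"

definition norm0 :: "'p::finite signal \<Rightarrow> nat" where
  "norm0 f = card {n. f n \<noteq> 0}"

text \<open>Conjugate-linear in the first argument.\<close>

definition scalar_prod :: "'p::finite signal \<Rightarrow> 'p signal \<Rightarrow> complex" where
  "scalar_prod x y = (\<Sum>j\<in>UNIV. cnj (x j) * y j)"

definition omega :: "nat \<Rightarrow> complex" where
  "omega N = exp (2 * pi * \<i> / N)"

definition translation :: "'p::finite mod_ring \<Rightarrow> 'p signal \<Rightarrow> 'p signal" where
  "translation p x = (\<lambda>n. x (n - p))"

definition modulation :: "'p::finite mod_ring \<Rightarrow> 'p signal \<Rightarrow> 'p signal" where
  "modulation l x = (\<lambda>n. omega CARD('p) powi to_int_mod_ring (l * n) * x n)"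

definition gabor :: "'p::finite signal \<Rightarrow> 'p mod_ring \<times> 'p mod_ring \<Rightarrow> 'p signal" where
  "gabor g = (\<lambda>(p, l). modulation l (translation p g))"

definition fourier_matrix :: "'p::finite mod_ring \<Rightarrow> 'p mod_ring \<Rightarrow> complex" where
  "fourier_matrix j n =
     omega CARD('p) powi (- to_int_mod_ring (j * n)) / sqrt (real CARD('p))"

definition fourier_sparse :: "nat \<Rightarrow> 'p::finite signal \<Rightarrow> bool" where
  "fourier_sparse k x \<longleftrightarrow>
     (\<exists>z. norm0 z \<le> k \<and> x = (\<lambda>j. \<Sum>n\<in>UNIV. fourier_matrix j n * z n))"

definition allows_fourier_sparse_phase_retrieval ::
    "nat \<Rightarrow> 'i set \<Rightarrow> ('i \<Rightarrow> 'p::finite signal) \<Rightarrow> bool" where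
  "allows_fourier_sparse_phase_retrieval k \<Lambda> \<phi> \<longleftrightarrow>
     (\<forall>x y. fourier_sparse k x \<and> fourier_sparse k y \<and>
        (\<forall>i\<in>\<Lambda>. cmod (scalar_prod x (\<phi> i)) = cmod (scalar_prod y (\<phi> i))) \<longrightarrow>
        (\<exists>c. cmod c = 1 \<and> x = (\<lambda>n. c * y n)))"

text \<open>
  A real polynomial in variables numbered by natural numbers is a finitely supported map from
  monomials to coefficients; a monomial is a finitely supported map from variables to exponents.
\<close>

type_synonym real_mpoly = "(nat \<Rightarrow>\<^sub>0 nat) \<Rightarrow>\<^sub>0 real"

definition mpoly_vars :: "real_mpoly \<Rightarrow> nat set" where
  "mpoly_vars P = (\<Union>m\<in>Poly_Mapping.keys P. Poly_Mapping.keys m)"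

definition mpoly_eval :: "real_mpoly \<Rightarrow> (nat \<Rightarrow> real) \<Rightarrow> real" where
  "mpoly_eval P v = (\<Sum>m\<in>Poly_Mapping.keys P. Poly_Mapping.lookup P m *
     (\<Prod>i\<in>Poly_Mapping.keys m. v i ^ Poly_Mapping.lookup m i))"

text \<open>The sequence \<open>Re g(0), Im g(0), Re g(1), Im g(1), \<dots>\<close>.\<close>

definition window_coords :: "'p::nontriv signal \<Rightarrow> nat \<Rightarrow> real" where
  "window_coords g i =
     (if even i then Re (g (of_nat (i div 2))) else Im (g (of_nat (i div 2))))"

text \<open>
  \<open>Q\<close> holds for generic windows supported in \<open>{0, \<dots>, k}\<close>.  The polynomial may involve only the
  first \<open>2(k+1)\<close> coordinates; as the real field is infinite, \<open>P \<noteq> 0\<close> is the same as \<open>P\<close> not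
  vanishing identically as a function of these coordinates.
\<close>

definition for_generic_window :: "nat \<Rightarrow> ('p::nontriv signal \<Rightarrow> bool) \<Rightarrow> bool" where
  "for_generic_window k Q \<longleftrightarrow>
     (\<exists>P::real_mpoly. P \<noteq> 0 \<and> mpoly_vars P \<subseteq> {..<2 * (k + 1)} \<and>
        (\<forall>g. {n. g n \<noteq> 0} \<subseteq> of_nat ` {0..k} \<longrightarrow>
             mpoly_eval P (window_coords g) \<noteq> 0 \<longrightarrow> Q g))"

end

theory Submission
  imports Defs
begin

text \<open>
  For a lag \<open>d\<close> let \<open>X\<^sub>d(n) = cnj (x(n + d)) * x(n)\<close>, and \<open>G\<^sub>d\<close> likewise for the window.  Expanding
  the square of a measurement turns it into \<open>\<Sum>\<^sub>d \<chi>(d l) * c\<^sub>d(p)\<close>, where \<open>\<chi>\<close> is the character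
  \<open>\<chi>(a) = \<omega>\<^sup>a\<close> and \<open>c\<^sub>d\<close> is the correlation of \<open>X\<^sub>d\<close> with the conjugate of \<open>G\<^sub>d\<close> (lemma
  \<open>spectrogram\<close>).  A window supported in \<open>{0, \<dots>, k}\<close> leaves only the \<open>2k + 1\<close> lags \<open>\<bar>d\<bar> \<le> k\<close>.  If
  \<open>x\<close> and \<open>y\<close> give the same measurements and \<open>\<Delta>\<^sub>d = X\<^sub>d - Y\<^sub>d\<close>, three vanishing statements follow one
  another.

  \<^enum> As a function of \<open>l\<close>, a combination of \<open>2k + 1\<close> characters vanishes on \<open>B\<close>, so the correlation of
    \<open>\<Delta>\<^sub>d\<close> with the conjugate of \<open>G\<^sub>d\<close> is zero at every \<open>p \<in> A\<close>.

  \<^enum> The frequencies of \<open>\<Delta>\<^sub>d\<close> are differences of two elements of the union of the spectra of \<open>x\<close> and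
    \<open>y\<close>, which has at most \<open>2k\<close> elements; there are at most \<open>2k (2k - 1) + 1\<close> of them.  The
    correlation has the same frequencies, and vanishes on \<open>A\<close>, so it vanishes identically.  Its
    coefficients are those of \<open>\<Delta>\<^sub>d\<close> times values of the ambiguity function of \<open>g\<close>; if the latter are
    nonzero, \<open>\<Delta>\<^sub>d = 0\<close>.

  \<^enum> A nonzero \<open>x\<close> with at most \<open>k\<close> frequencies does not vanish at \<open>k\<close> consecutive points.  So the
    equalities \<open>X\<^sub>d = Y\<^sub>d\<close> for \<open>0 \<le> d \<le> k\<close>, which compare the phases of any two nonzero entries at
    distance at most \<open>k\<close>, carry one common phase factor around the whole cycle (lemma
    \<open>lag_products_determine_signal\<close>).

  All three rest on Chebotarev's theorem, in the form: a combination of \<open>m\<close> characters of a cyclic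
  group of prime order that vanishes at \<open>m\<close> points is zero (lemma \<open>chebotarev_mod_ring\<close>).  Its proof
  extends the \<open>p\<close>-adic valuation to the field of complex numbers: modulo the maximal ideal of a
  valuation ring, all \<open>p\<close>-th roots of unity become 1, and \<open>m\<close> distinct zeros of a polynomial become
  one zero of multiplicity \<open>m\<close>, which is too much for a nonzero polynomial of degree below \<open>p\<close> with at
  most \<open>m\<close> terms in characteristic \<open>p\<close>.

  The genericity condition is that the ambiguity function of \<open>g\<close> has no zero at the lags
  \<open>0, \<dots>, k\<close>.  The product of its squared absolute values is a polynomial in the coordinates of \<open>g\<close>,
  and it is not zero at the window \<open>g(m) = 2\<^sup>m\<close>, for which the ambiguity function is a geometric sum.
\<close>

section \<open>Subrings of a field that are maximal without a given element\<close>

definition is_subring :: "'a::comm_ring_1 set \<Rightarrow> bool" where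
  "is_subring R \<longleftrightarrow> 1 \<in> R \<and> (\<forall>x\<in>R. \<forall>y\<in>R. x - y \<in> R \<and> x * y \<in> R)"

lemma subring_0: "is_subring R \<Longrightarrow> 0 \<in> R"
  unfolding is_subring_def by (metis diff_self)

lemma subring_1: "is_subring R \<Longrightarrow> 1 \<in> R"
  unfolding is_subring_def by blast

lemma subring_mult: "is_subring R \<Longrightarrow> x \<in> R \<Longrightarrow> y \<in> R \<Longrightarrow> x * y \<in> R"
  unfolding is_subring_def by blast

lemma subring_diff: "is_subring R \<Longrightarrow> x \<in> R \<Longrightarrow> y \<in> R \<Longrightarrow> x - y \<in> R"
  unfolding is_subring_def by blast

lemma subring_add:
  assumes "is_subring R" "x \<in> R" "y \<in> R" shows "x + y \<in> R"
proof -
  have "x - (0 - y) \<in> R"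
    using assms by (intro subring_diff subring_0)
  then show ?thesis by simp
qed

lemma subring_power: "is_subring R \<Longrightarrow> x \<in> R \<Longrightarrow> x ^ n \<in> R"
  by (induction n) (auto intro: subring_1 subring_mult)

lemma subring_sum: "is_subring R \<Longrightarrow> (\<And>i. i \<in> I \<Longrightarrow> f i \<in> R) \<Longrightarrow> sum f I \<in> R"
  by (induction I rule: infinite_finite_induct) (auto intro: subring_0 subring_add)

lemma subring_of_nat: "is_subring R \<Longrightarrow> of_nat n \<in> R"
  by (induction n) (auto intro: subring_0 subring_1 subring_add)

lemma subring_of_int: "is_subring R \<Longrightarrow> of_int n \<in> R"
proof (cases n)
  case (neg m)
  assume R: "is_subring R"
  have "0 - of_nat (Suc m) \<in> R"
    by (intro subring_diff subring_0 subring_of_nat R)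
  then show ?thesis
    by (simp add: neg)
qed (simp add: subring_of_nat)

definition polys_over :: "'a::zero set \<Rightarrow> 'a poly set" where
  "polys_over R = {q. \<forall>i. coeff q i \<in> R}"

lemma poly_in_subring:
  "is_subring R \<Longrightarrow> q \<in> polys_over R \<Longrightarrow> x \<in> R \<Longrightarrow> poly q x \<in> R"
  unfolding poly_altdef polys_over_def
  by (auto intro!: subring_sum subring_mult subring_power)

lemma polys_over_subring: "is_subring R \<Longrightarrow> is_subring (polys_over R)"
  unfolding is_subring_def[of "polys_over R"]
  by (auto simp: polys_over_def coeff_mult coeff_1
      intro!: subring_diff subring_sum subring_mult subring_0 subring_1)

lemma monom_in_polys_over: "is_subring R \<Longrightarrow> c \<in> R \<Longrightarrow> monom c n \<in> polys_over R"
  by (auto simp: polys_over_def intro: subring_0)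

lemma smult_in_polys_over:
  "is_subring R \<Longrightarrow> c \<in> R \<Longrightarrow> q \<in> polys_over R \<Longrightarrow> smult c q \<in> polys_over R"
  by (auto simp: polys_over_def intro: subring_mult)

lemma reflect_in_polys_over:
  "is_subring R \<Longrightarrow> q \<in> polys_over R \<Longrightarrow> reflect_poly q \<in> polys_over R"
  by (auto simp: polys_over_def coeff_reflect_poly intro: subring_0)

definition adjoin :: "'a::comm_ring_1 set \<Rightarrow> 'a \<Rightarrow> 'a set" where
  "adjoin R x = (\<lambda>q. poly q x) ` polys_over R"

lemma adjoin_subring:
  assumes "is_subring R" shows "is_subring (adjoin R x)"
proof -
  note P = polys_over_subring[OF assms]
  have "1 \<in> adjoin R x"
    unfolding adjoin_def using subring_1[OF P] by (intro image_eqI[of _ _ 1]) auto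
  moreover have "a - b \<in> adjoin R x \<and> a * b \<in> adjoin R x"
    if "a \<in> adjoin R x" "b \<in> adjoin R x" for a b
  proof -
    from that have "\<exists>f\<in>polys_over R. a = poly f x" "\<exists>f\<in>polys_over R. b = poly f x"
      unfolding adjoin_def by blast+
    then obtain f g where fg: "f \<in> polys_over R" "g \<in> polys_over R" "a = poly f x" "b = poly g x"
      by blast
    have "a - b = poly (f - g) x" "a * b = poly (f * g) x"
      by (simp_all add: fg)
    then show ?thesis
      unfolding adjoin_def using fg subring_diff[OF P] subring_mult[OF P] by blast
  qed
  ultimately show ?thesis
    unfolding is_subring_def by blast
qed

lemma subset_adjoin:
  assumes "is_subring R" shows "R \<subseteq> adjoin R x"
proof
  fix c assume "c \<in> R"
  then have "monom c 0 \<in> polys_over R" by (rule monom_in_polys_over[OF assms])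
  then show "c \<in> adjoin R x"
    unfolding adjoin_def by (rule rev_image_eqI) (simp add: poly_monom)
qed

lemma mem_adjoin:
  assumes "is_subring R" shows "x \<in> adjoin R x"
proof -
  have "monom 1 1 \<in> polys_over R" by (intro monom_in_polys_over subring_1 assms)
  then show ?thesis
    unfolding adjoin_def by (rule rev_image_eqI) (simp add: poly_monom)
qed

lemma maximal_subring_exists:
  fixes a :: "'a::comm_ring_1"
  assumes R0: "is_subring R0" "a \<notin> R0"
  obtains R where "is_subring R" "R0 \<subseteq> R" "a \<notin> R" "\<And>x. x \<notin> R \<Longrightarrow> a \<in> adjoin R x"
proof -
  let ?A = "{R. is_subring R \<and> R0 \<subseteq> R \<and> a \<notin> R}"
  have "\<exists>M\<in>?A. \<forall>X\<in>?A. M \<subseteq> X \<longrightarrow> X = M"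
  proof (rule subset_Zorn_nonempty)
    show "?A \<noteq> {}" using R0 by blast
  next
    fix \<C> assume ne: "\<C> \<noteq> {}" and ch: "subset.chain ?A \<C>"
    have sub: "is_subring R \<and> R0 \<subseteq> R \<and> a \<notin> R" if "R \<in> \<C>" for R
      using ch that unfolding subset_chain_def by blast
    have "is_subring (\<Union>\<C>)"
      unfolding is_subring_def
    proof (intro conjI ballI)
      show "1 \<in> \<Union>\<C>" using ne sub subring_1 by blast
      fix x y assume "x \<in> \<Union>\<C>" "y \<in> \<Union>\<C>"
      then obtain X Y where XY: "X \<in> \<C>" "Y \<in> \<C>" "x \<in> X" "y \<in> Y" by blast
      then have "X \<subseteq> Y \<or> Y \<subseteq> X" using ch unfolding subset_chain_def by blast
      then obtain Z where "Z \<in> \<C>" "x \<in> Z" "y \<in> Z" using XY by blast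
      then show "x - y \<in> \<Union>\<C>" "x * y \<in> \<Union>\<C>"
        using sub subring_diff subring_mult by blast+
    qed
    then show "\<Union>\<C> \<in> ?A" using sub ne by blast
  qed
  then obtain R where R: "is_subring R" "R0 \<subseteq> R" "a \<notin> R"
    and "\<forall>X\<in>?A. R \<subseteq> X \<longrightarrow> X = R"
    by blast
  then have max: "\<And>X. is_subring X \<Longrightarrow> a \<notin> X \<Longrightarrow> R \<subseteq> X \<Longrightarrow> X = R"
    by (auto dest: order.trans)
  have "a \<in> adjoin R x" if "x \<notin> R" for x
    using max[OF adjoin_subring[OF R(1)]] subset_adjoin[OF R(1)] mem_adjoin[OF R(1)] that
    by metis
  with R that show thesis by blast
qed

text \<open>
  Otherwise \<open>a\<close> would be a polynomial in the inverse of \<open>u = 1 - b / a\<close>, so \<open>a * u ^ n\<close> would lie in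
  \<open>R\<close> for some \<open>n\<close>.  As \<open>a * u ^ n = a * u ^ (n + 1) + b * u ^ n\<close>, the exponent can be lowered to 0,
  which contradicts \<open>a \<notin> R\<close>.
\<close>
lemma one_minus_multiple_unit:
  fixes a :: "'a::field"
  assumes R: "is_subring R" and a: "a \<notin> R" and ia: "inverse a \<in> R"
    and max: "\<And>x. x \<notin> R \<Longrightarrow> a \<in> adjoin R x"
    and b: "b \<in> R"
  shows "inverse (1 - inverse a * b) \<in> R" "1 - inverse a * b \<noteq> 0"
proof -
  let ?u = "1 - inverse a * b"
  have a0: "a \<noteq> 0" using a subring_0[OF R] by auto
  have uR: "?u \<in> R" using R ia b by (intro subring_diff subring_mult subring_1)
  show u0: "?u \<noteq> 0"
  proof
    assume "?u = 0"
    then have "a = b" using a0 by (simp add: field_simps)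
    then show False using a b by simp
  qed
  show "inverse ?u \<in> R"
  proof (rule ccontr)
    assume "inverse ?u \<notin> R"
    then obtain q where q: "q \<in> polys_over R" "a = poly q (inverse ?u)"
      using max unfolding adjoin_def by blast
    have "a * ?u ^ degree q = poly (reflect_poly q) ?u"
      using u0 q(2) by (simp add: poly_reflect_poly_nz)
    also have "\<dots> \<in> R"
      using R q uR by (intro poly_in_subring reflect_in_polys_over)
    finally have "a * ?u ^ degree q \<in> R" .
    moreover have "a * ?u ^ n \<in> R \<Longrightarrow> a \<in> R" for n
    proof (induction n)
      case (Suc n)
      have "a * ?u ^ n = a * ?u ^ Suc n + b * ?u ^ n"
        using a0 by (simp add: algebra_simps)
      also have "\<dots> \<in> R"
        using R by (intro subring_add Suc.prems subring_mult[OF R b] subring_power uR)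
      finally show ?case using Suc.IH by blast
    qed simp
    ultimately show False using a by blast
  qed
qed

text \<open>
  Since \<open>1 - b / a\<close> is a unit, where \<open>b\<close> is the constant term of \<open>g\<close>, the equation
  \<open>poly g (inverse x) = a\<close> can be solved for 1 as a polynomial in \<open>inverse x\<close> without constant term.
  Multiplied by \<open>x ^ n\<close> with \<open>n = degree f \<ge> degree g\<close>, it expresses \<open>x ^ n\<close> by lower powers of \<open>x\<close>;
  substituting this for the leading term of \<open>f\<close> lowers the degree.
\<close>
lemma shorter_representation:
  fixes a :: "'a::field"
  assumes R: "is_subring R" and a: "a \<notin> R" and ia: "inverse a \<in> R"
    and max: "\<And>x. x \<notin> R \<Longrightarrow> a \<in> adjoin R x"
    and x0: "x \<noteq> 0"
    and f: "f \<in> polys_over R" "poly f x = a"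
    and g: "g \<in> polys_over R" "poly g (inverse x) = a"
    and le: "degree g \<le> degree f"
  obtains f' where "f' \<in> polys_over R" "poly f' x = a" "degree f' < degree f"
proof -
  note P = polys_over_subring[OF R]
  define n where "n = degree f"
  define c where "c = coeff f n"
  obtain b g' where gg: "g = pCons b g'" by (cases g)
  have b: "b \<in> R" using g(1) unfolding gg polys_over_def by (auto dest: spec[of _ 0])
  have g': "g' \<in> polys_over R"
    using g(1) unfolding gg polys_over_def by (auto dest: spec[of _ "Suc _"])
  have g'0: "g' \<noteq> 0" using g(2) a b unfolding gg by auto
  then have dg: "degree g = Suc (degree g')" unfolding gg by simp
  define u where "u = 1 - inverse a * b"
  have u: "inverse u \<in> R" "u \<noteq> 0"
    unfolding u_def using one_minus_multiple_unit[OF R a ia max b] by auto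
  have a0: "a \<noteq> 0" using a subring_0[OF R] by auto
  define h where "h = smult (inverse a * inverse u) (monom 1 (n - degree g) * reflect_poly g')"
  have h: "h \<in> polys_over R"
    unfolding h_def using R ia u g'
    by (intro smult_in_polys_over subring_mult[OF P] subring_mult[OF R] monom_in_polys_over
        reflect_in_polys_over subring_1)
  have "degree h \<le> (n - degree g) + degree g'"
    unfolding h_def
    by (intro order.trans[OF degree_smult_le] order.trans[OF degree_mult_le] add_mono
        degree_monom_le degree_reflect_poly_le)
  then have dh: "degree h < n" using dg le n_def by simp
  have "a * u = a - b"
    using a0 by (simp add: u_def right_diff_distrib)
  then have eq: "inverse x * poly g' (inverse x) = a * u"
    using g(2) unfolding gg by auto
  have "poly h x = inverse a * inverse u * (x ^ (n - degree g) * (x ^ degree g' * poly g' (inverse x)))"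
    using x0 by (simp add: h_def poly_monom poly_reflect_poly_nz)
  also have "\<dots> = inverse a * inverse u * (x ^ (n - degree g + degree g' + 1) * (inverse x * poly g' (inverse x)))"
    using x0 by (simp add: power_add)
  also have "n - degree g + degree g' + 1 = n" using dg le n_def by simp
  also have "inverse a * inverse u * (x ^ n * (inverse x * poly g' (inverse x))) = x ^ n"
    unfolding eq using a0 u(2) by (simp add: field_simps)
  finally have hx: "poly h x = x ^ n" .
  define f' where "f' = (f - monom c n) + smult c h"
  have cR: "c \<in> R" using f(1) by (simp add: c_def polys_over_def)
  have "f' \<in> polys_over R"
    unfolding f'_def using R f cR h
    by (intro subring_add[OF P] subring_diff[OF P] smult_in_polys_over monom_in_polys_over)
  moreover have "poly f' x = a"
    using f(2) hx by (simp add: f'_def poly_monom)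
  moreover have "degree f' < n"
  proof -
    have "coeff f' i = 0" if "i \<ge> n" for i
      using that dh by (auto simp: f'_def c_def n_def coeff_eq_0)
    then have "degree f' \<le> n - 1" by (intro degree_le) auto
    then show ?thesis using dg le n_def by simp
  qed
  ultimately show thesis using that n_def by blast
qed

text \<open>
  A subring that is maximal without \<open>a\<close> has the required property: if \<open>x\<close> and \<open>inverse x\<close> were both
  missing, \<open>a\<close> would be a polynomial in each of them.  Of two such polynomials of least degree, the
  longer one could be shortened by means of the other.
\<close>
lemma valuation_subring_exists:
  fixes a :: "'a::field"
  assumes R0: "is_subring R0" "a \<notin> R0" "inverse a \<in> R0"
  obtains R where "is_subring R" "R0 \<subseteq> R" "a \<notin> R" "\<And>x. x \<in> R \<or> inverse x \<in> R"
proof -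
  obtain R where R: "is_subring R" "R0 \<subseteq> R" "a \<notin> R" and max: "\<And>x. x \<notin> R \<Longrightarrow> a \<in> adjoin R x"
    using maximal_subring_exists[OF R0(1,2)] by metis
  have ia: "inverse a \<in> R" using R0(3) R(2) by blast
  have shortest: "\<exists>f\<in>polys_over R. poly f x = a \<and>
      (\<forall>f'\<in>polys_over R. poly f' x = a \<longrightarrow> degree f \<le> degree f')" if x: "x \<notin> R" for x
  proof -
    obtain f where "f \<in> polys_over R \<and> poly f x = a"
      using max[OF x] unfolding adjoin_def by blast
    from ex_has_least_nat[where P = "\<lambda>f. f \<in> polys_over R \<and> poly f x = a" and m = degree, OF this]
    show ?thesis by blast
  qed
  have "x \<in> R \<or> inverse x \<in> R" for x
  proof (rule ccontr)
    assume "\<not> (x \<in> R \<or> inverse x \<in> R)"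
    then have x: "x \<notin> R" "inverse x \<notin> R" by blast+
    then have x0: "x \<noteq> 0" using subring_0[OF R(1)] by auto
    obtain f where f: "f \<in> polys_over R" "poly f x = a"
      and fmin: "\<And>f'. f' \<in> polys_over R \<Longrightarrow> poly f' x = a \<Longrightarrow> degree f \<le> degree f'"
      using shortest[OF x(1)] by blast
    obtain g where g: "g \<in> polys_over R" "poly g (inverse x) = a"
      and gmin: "\<And>g'. g' \<in> polys_over R \<Longrightarrow> poly g' (inverse x) = a \<Longrightarrow> degree g \<le> degree g'"
      using shortest[OF x(2)] by blast
    show False
    proof (cases "degree g \<le> degree f")
      case True
      then show False
        using shorter_representation[OF R(1,3) ia max x0 f g] fmin by (metis not_less)
    next
      case False
      then have "degree f \<le> degree g" by simp
      moreover have "inverse x \<noteq> 0" "poly f (inverse (inverse x)) = a" using x0 f by auto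
      ultimately show False
        using shorter_representation[OF R(1,3) ia max _ g f(1)] gmin by (metis not_less)
    qed
  qed
  with R that show thesis by blast
qed

section \<open>The maximal ideal of a valuation ring of residue characteristic p\<close>

locale residue_char_valuation =
  fixes R :: "'a::field_char_0 set" and p :: nat
  assumes subring: "is_subring R"
    and total: "x \<in> R \<or> inverse x \<in> R"
    and prime_p: "prime p"
    and p_nonunit: "inverse (of_nat p) \<notin> R"
begin

definition nonunits :: "'a set" where
  "nonunits = {x \<in> R. x = 0 \<or> inverse x \<notin> R}"

lemma nonunits_mult:
  assumes "y \<in> R" "x \<in> nonunits" shows "y * x \<in> nonunits"
proof -
  have "inverse x \<in> R" if nz: "y * x \<noteq> 0" and "inverse (y * x) \<in> R"
  proof -
    have "inverse x = y * inverse (y * x)" using nz by (simp add: field_simps)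
    then show ?thesis using subring_mult[OF subring assms(1) that(2)] by metis
  qed
  then show ?thesis
    using assms subring_mult[OF subring] unfolding nonunits_def by auto
qed

lemma nonunits_uminus: "x \<in> nonunits \<Longrightarrow> - x \<in> nonunits"
  using nonunits_mult[OF subring_of_int[OF subring, of "- 1"], of x] by simp

lemma nonunits_add_if_quotient_mem:
  assumes x: "x \<in> nonunits" and y: "y \<in> nonunits" and y0: "y \<noteq> 0" and xy: "x / y \<in> R"
  shows "x + y \<in> nonunits"
proof -
  have "x + y = (1 + x / y) * y" using y0 by (simp add: field_simps)
  then show ?thesis
    using nonunits_mult[OF subring_add[OF subring subring_1[OF subring] xy] y] by simp
qed

lemma nonunits_add:
  assumes x: "x \<in> nonunits" and y: "y \<in> nonunits"
  shows "x + y \<in> nonunits"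
proof (cases "x = 0 \<or> y = 0")
  case True
  then show ?thesis using x y by auto
next
  case False
  have "x / y \<in> R \<or> y / x \<in> R"
    using total[of "x / y"] by simp
  then show ?thesis
    using nonunits_add_if_quotient_mem[of x y] nonunits_add_if_quotient_mem[of y x] x y False by (auto simp: add.commute)
qed

lemma nonunits_0: "0 \<in> nonunits"
  unfolding nonunits_def using subring_0[OF subring] by simp

lemma nonunits_sum: "(\<And>i. i \<in> I \<Longrightarrow> f i \<in> nonunits) \<Longrightarrow> sum f I \<in> nonunits"
  by (induction I rule: infinite_finite_induct) (auto intro: nonunits_0 nonunits_add)

lemma one_not_nonunit: "1 \<notin> nonunits"
  unfolding nonunits_def using subring_1[OF subring] by simp

lemma p_in_nonunits: "of_nat p \<in> nonunits"
  unfolding nonunits_def using subring_of_nat[OF subring] p_nonunit by simp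

text \<open>
  An integer prime to \<open>p\<close> generates 1 together with \<open>p\<close>, which is a nonunit.
\<close>
lemma of_int_nonunit_imp_dvd:
  assumes "of_int n \<in> nonunits" shows "int p dvd n"
proof (rule ccontr)
  assume "\<not> int p dvd n"
  then have "coprime n (int p)"
    using prime_p by (metis coprime_commute prime_imp_coprime prime_nat_int_transfer)
  then obtain u v where uv: "u * n + v * int p = 1"
    using bezout_int[of n "int p"] by auto
  have "of_int u * of_int n + of_int v * of_nat p \<in> nonunits"
    by (intro nonunits_add nonunits_mult assms p_in_nonunits subring_of_int subring)
  also have "of_int u * of_int n + of_int v * of_nat p = (of_int (u * n + v * int p) :: 'a)"
    by simp
  finally show False
    unfolding uv using one_not_nonunit by simp
qed

lemma root_of_unity_mem:
  assumes t: "t ^ p = 1" shows "t \<in> R"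
proof -
  have p: "p > 0" using prime_p by (simp add: prime_gt_0_nat)
  have t0: "t \<noteq> 0" using t p by (metis zero_neq_one zero_power)
  have "t * t ^ (p - 1) = 1" using t p by (simp add: power_eq_if)
  then have "t = inverse t ^ (p - 1)"
    using t0 by (simp add: field_simps power_inverse)
  then show ?thesis
    using total[of t] subring_power[OF subring, of "inverse t" "p - 1"] by auto
qed

text \<open>
  Modulo \<open>p\<close> one has \<open>(t - 1)\<^sup>p = t\<^sup>p - 1 = 0\<close>.  So \<open>(t - 1)\<^sup>p\<close> is a nonunit, and hence so is
  \<open>t - 1\<close>.
\<close>
lemma root_of_unity_cong_1:
  assumes t: "t ^ p = 1" shows "t - 1 \<in> nonunits"
proof (rule ccontr)
  assume nu: "t - 1 \<notin> nonunits"
  let ?d = "t - 1"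
  have dR: "?d \<in> R"
    by (intro subring_diff subring_1 root_of_unity_mem subring t)
  then have d0: "?d \<noteq> 0" and inv: "inverse ?d \<in> R"
    using nu unfolding nonunits_def by auto
  have p: "p > 0" using prime_p by (simp add: prime_gt_0_nat)
  have "1 = (?d + 1) ^ p" using t by simp
  also have "\<dots> = (\<Sum>k\<le>p. of_nat (p choose k) * ?d ^ k)"
    by (subst binomial_ring) simp
  also have "{..p} = insert p (insert 0 {0<..<p})" using p by auto
  also have "(\<Sum>k\<in>insert p (insert 0 {0<..<p}). of_nat (p choose k) * ?d ^ k) =
      ?d ^ p + 1 + (\<Sum>k\<in>{0<..<p}. of_nat (p choose k) * ?d ^ k)"
    using p by (simp add: add.assoc)
  finally have eq: "?d ^ p = - (\<Sum>k\<in>{0<..<p}. of_nat (p choose k) * ?d ^ k)"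
    by (simp add: algebra_simps eq_neg_iff_add_eq_0)
  have "of_nat (p choose k) * ?d ^ k \<in> nonunits" if k: "k \<in> {0<..<p}" for k
  proof -
    have "p dvd p choose k"
      using k prime_p by (intro dvd_choose_prime) auto
    then obtain j where j: "p choose k = p * j" by blast
    have "(of_nat j * ?d ^ k) * of_nat p \<in> nonunits"
      by (intro nonunits_mult p_in_nonunits subring_mult subring_of_nat subring_power subring dR)
    then show ?thesis by (simp add: j mult_ac)
  qed
  then have "?d ^ p \<in> nonunits"
    unfolding eq by (intro nonunits_uminus nonunits_sum)
  then have "inverse ?d ^ p * ?d ^ p \<in> nonunits"
    by (intro nonunits_mult[OF subring_power[OF subring inv]])
  also have "inverse ?d ^ p * ?d ^ p = 1"
    using d0 by (simp add: power_inverse)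
  finally show False using one_not_nonunit by simp
qed

lemma synthetic_div_in_polys_over:
  assumes "t \<in> R" shows "P \<in> polys_over R \<Longrightarrow> synthetic_div P t \<in> polys_over R"
proof (induction P)
  case 0
  then show ?case by simp
next
  case (pCons a P)
  have P: "P \<in> polys_over R"
    using pCons.prems unfolding polys_over_def by (auto dest: spec[of _ "Suc _"])
  show ?case
    using pCons.IH[OF P] poly_in_subring[OF subring P assms]
    by (auto simp: polys_over_def coeff_pCons split: nat.split)
qed

end

section \<open>Chebotarev's theorem on roots of unity\<close>

definition forward_difference :: "int poly \<Rightarrow> int poly" where
  "forward_difference L = pcompose L [:1, 1:] - L"

lemma poly_forward_difference:
  "poly (forward_difference L) x = poly L (x + 1) - poly L x"
  by (simp add: forward_difference_def poly_pcompose add.commute)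

lemma degree_forward_difference:
  "forward_difference L = 0 \<or> degree (forward_difference L) < degree L"
proof (induction L)
  case 0
  then show ?case by (simp add: forward_difference_def)
next
  case (pCons a L)
  have eq: "forward_difference (pCons a L) = pCons 0 (forward_difference L) + pcompose L [:1, 1:]"
    by (simp add: forward_difference_def pcompose_pCons algebra_simps)
  show ?case
  proof (cases "L = 0")
    case True
    then show ?thesis by (simp add: forward_difference_def)
  next
    case False
    have "degree (pcompose L [:1, 1:]) = degree L" by simp
    moreover have "degree (pCons 0 (forward_difference L)) \<le> degree L"
      using pCons.IH by (auto simp: degree_pCons_eq_if)
    ultimately have "degree (forward_difference (pCons a L)) \<le> degree L"
      unfolding eq by (intro degree_add_le) auto
    then show ?thesis using False by simp
  qed
qed

context residue_char_valuation
begin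

text \<open>
  Modulo the nonunits, \<open>P\<close> has the zero 1 with multiplicity at least \<open>card T\<close>.  For a zero of
  multiplicity \<open>m\<close> the derivatives of order below \<open>m\<close> vanish, which makes zero all
  sums of the coefficients weighted by the values at the exponents of a polynomial \<open>L\<close> of degree
  below \<open>m\<close>.  Dividing \<open>P\<close> by one linear factor replaces \<open>L\<close> by its forward difference, up to
  nonunits, which lowers its degree; this gives an induction on \<open>T\<close>.
\<close>
lemma moments_nonunits:
  assumes "finite T" "\<And>t. t \<in> T \<Longrightarrow> t \<in> R \<and> t - 1 \<in> nonunits"
    and "P \<in> polys_over R" "\<And>t. t \<in> T \<Longrightarrow> poly P t = 0"
    and "L = 0 \<or> degree L < card T" and "degree P \<le> n"
  shows "(\<Sum>s\<le>n. coeff P s * of_int (poly L (int s))) \<in> nonunits"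
  using assms
proof (induction T arbitrary: P L rule: finite_induct)
  case empty
  then show ?case by (simp add: nonunits_0)
next
  case (insert t T)
  define Q where "Q = synthetic_div P t"
  have t: "t \<in> R" "t - 1 \<in> nonunits" using insert.prems(1) by auto
  have Q: "Q \<in> polys_over R"
    unfolding Q_def by (intro synthetic_div_in_polys_over t insert.prems)
  have PQ: "P = pCons 0 Q - smult t Q"
    using synthetic_div_correct[of P t] insert.prems(3)[of t] by (simp add: Q_def algebra_simps)
  have zeroQ: "poly Q u = 0" if u: "u \<in> T" for u
  proof -
    have "(u - t) * poly Q u = 0"
      using insert.prems(3)[of u] u by (simp add: PQ algebra_simps)
    then show ?thesis using u insert.hyps(2) by auto
  qed
  have dQ: "degree Q = degree P - 1" unfolding Q_def by (rule degree_synthetic_div)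
  have Qn: "coeff Q n = 0"
  proof (cases "degree P = 0")
    case True
    then show ?thesis by (simp add: Q_def synthetic_div_eq_0_iff[THEN iffD2])
  next
    case False
    then show ?thesis using dQ insert.prems(5) by (intro coeff_eq_0) auto
  qed
  let ?D = "forward_difference L"
  have "(\<Sum>s\<le>n. coeff P s * of_int (poly L (int s))) =
      (\<Sum>s\<le>n. coeff (pCons 0 Q) s * of_int (poly L (int s)))
      - t * (\<Sum>s\<le>n. coeff Q s * of_int (poly L (int s)))"
    by (simp add: PQ left_diff_distrib sum_subtractf sum_distrib_left mult.assoc)
  also have "(\<Sum>s\<le>n. coeff (pCons 0 Q) s * of_int (poly L (int s))) =
      (\<Sum>s\<le>Suc n. coeff (pCons 0 Q) s * of_int (poly L (int s)))"
    by (simp add: Qn)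
  also have "\<dots> = (\<Sum>s\<le>n. coeff Q s * of_int (poly L (int s + 1)))"
    by (subst sum.atMost_Suc_shift) (simp add: add.commute)
  also have "\<dots> - t * (\<Sum>s\<le>n. coeff Q s * of_int (poly L (int s))) =
      (\<Sum>s\<le>n. coeff Q s * of_int (poly ?D (int s)))
      + - ((\<Sum>s\<le>n. coeff Q s * of_int (poly L (int s))) * (t - 1))"
    by (simp add: poly_forward_difference right_diff_distrib sum_subtractf algebra_simps)
  finally have eq: "(\<Sum>s\<le>n. coeff P s * of_int (poly L (int s))) = \<dots>" .
  have "(\<Sum>s\<le>n. coeff Q s * of_int (poly ?D (int s))) \<in> nonunits"
  proof (rule insert.IH[OF _ Q zeroQ])
    show "?D = 0 \<or> degree ?D < card T"
      using degree_forward_difference[of L] insert.prems(4) insert.hyps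
      by (auto simp: forward_difference_def)
    show "degree Q \<le> n" using dQ insert.prems(5) by simp
  qed (use insert.prems in auto)
  moreover have "(\<Sum>s\<le>n. coeff Q s * of_int (poly L (int s))) * (t - 1) \<in> nonunits"
    using Q by (intro nonunits_mult t subring_sum subring_mult subring_of_int subring)
      (simp add: polys_over_def)
  ultimately show ?case
    unfolding eq by (intro nonunits_add nonunits_uminus)
qed

text \<open>
  The nonzero values are totally preordered by divisibility in \<open>R\<close>.  Dividing by one that divides all
  the others makes all values integral and one of them 1.
\<close>
lemma nonzero_value_dividing_all:
  assumes "finite S"
  shows "(\<forall>s\<in>S. c s = 0) \<or> (\<exists>s0\<in>S. c s0 \<noteq> 0 \<and> (\<forall>s\<in>S. c s / c s0 \<in> R))"
  using assms
proof induction
  case empty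
  then show ?case by simp
next
  case (insert s S)
  have R01: "0 \<in> R" "1 \<in> R" using subring subring_0 subring_1 by blast+
  from insert.IH show ?case
  proof (elim disjE bexE conjE)
    assume "\<forall>s\<in>S. c s = 0"
    then show ?thesis using R01 by (cases "c s = 0") auto
  next
    fix s0 assume s0: "s0 \<in> S" "c s0 \<noteq> 0" "\<forall>s\<in>S. c s / c s0 \<in> R"
    show ?thesis
    proof (cases "c s / c s0 \<in> R")
      case True
      then show ?thesis using s0 by auto
    next
      case False
      then have ds: "c s \<noteq> 0" "c s0 / c s \<in> R"
        using total[of "c s / c s0"] R01 by auto
      have "c r / c s \<in> R" if "r \<in> S" for r
      proof -
        have "c r / c s = (c r / c s0) * (c s0 / c s)" using s0(2) by simp
        then show ?thesis using subring_mult[OF subring, of "c r / c s0" "c s0 / c s"] s0(3) that ds(2)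
          by metis
      qed
      then show ?thesis using ds(1) R01 by (intro disjI2 bexI[of _ s]) auto
    qed
  qed
qed

end

text \<open>
  After scaling, the coefficients lie in a valuation ring and one of them, at the exponent \<open>s0\<close>, is 1.
  The moment for the polynomial \<open>L\<close> with the remaining exponents as its zeros is
  \<open>\<Prod>s\<in>S - {s0}. s0 - s\<close>.  It would have to be a nonunit, but no factor is divisible by \<open>p\<close>.
\<close>
theorem chebotarev_roots_of_unity:
  fixes c :: "nat \<Rightarrow> 'a::field_char_0"
  assumes p: "prime p"
    and T: "finite T" "\<And>t. t \<in> T \<Longrightarrow> t ^ p = 1"
    and S: "S \<subseteq> {..<p}" "card S \<le> card T"
    and zero: "\<And>t. t \<in> T \<Longrightarrow> (\<Sum>s\<in>S. c s * t ^ s) = 0"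
    and s: "s \<in> S"
  shows "c s = 0"
proof (rule ccontr)
  assume cs: "c s \<noteq> 0"
  have finS: "finite S" using S(1) finite_subset by blast
  have Z: "is_subring (range (of_int :: int \<Rightarrow> 'a))"
    unfolding is_subring_def
  proof (intro conjI ballI)
    show "1 \<in> range (of_int :: int \<Rightarrow> 'a)" by (metis of_int_1 rangeI)
  qed (auto simp flip: of_int_diff of_int_mult)
  have "inverse (of_nat p) \<notin> range (of_int :: int \<Rightarrow> 'a)"
  proof
    assume "inverse (of_nat p) \<in> range (of_int :: int \<Rightarrow> 'a)"
    then obtain m :: int where m: "inverse (of_nat p) = (of_int m :: 'a)" by blast
    have "of_int (int p * m) = of_nat p * (of_int m :: 'a)" by simp
    also have "\<dots> = of_int 1" unfolding m[symmetric] using p by (simp add: prime_gt_0_nat)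
    finally have "int p * m = 1" by (simp only: of_int_eq_iff)
    then show False using p by (auto simp: zmult_eq_1_iff)
  qed
  moreover have "inverse (inverse (of_nat p)) \<in> range (of_int :: int \<Rightarrow> 'a)"
    by (metis inverse_inverse_eq of_int_of_nat_eq rangeI)
  ultimately obtain R :: "'a set" where "is_subring R" "inverse (of_nat p) \<notin> R"
      "\<And>x. x \<in> R \<or> inverse x \<in> R"
    using valuation_subring_exists[OF Z] by metis
  then interpret residue_char_valuation R p
    by unfold_locales (use p in auto)
  \<comment> \<open>Scaling makes all coefficients integral and one of them equal to 1.\<close>
  obtain s0 where s0: "s0 \<in> S" "c s0 \<noteq> 0" "\<And>s. s \<in> S \<Longrightarrow> c s / c s0 \<in> R"
    using nonzero_value_dividing_all[OF finS, of c] cs s by blast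
  define P where "P = (\<Sum>s\<in>S. monom (c s / c s0) s)"
  define L where "L = (\<Prod>s\<in>S - {s0}. [:- int s, 1:])"
  have P: "P \<in> polys_over R"
    unfolding P_def by (intro subring_sum polys_over_subring subring monom_in_polys_over s0)
  have coeffP: "coeff P j = (if j \<in> S then c j / c s0 else 0)" for j
    using finS by (simp add: P_def coeff_sum)
  have polyP: "poly P t = 0" if "t \<in> T" for t
    using zero[OF that] by (simp add: P_def poly_sum poly_monom flip: sum_divide_distrib)
  have "card S > 0" using finS s0(1) card_gt_0_iff by blast
  have "degree L \<le> (\<Sum>s\<in>S - {s0}. degree [:- int s, 1:])"
    unfolding L_def using degree_prod_sum_le[of "S - {s0}" "\<lambda>s. [:- int s, 1:]"] finS by simp
  also have "\<dots> < card S"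
    using finS s0(1) \<open>card S > 0\<close> by simp
  finally have dL: "degree L < card T" using S(2) by simp
  have dP: "degree P \<le> p"
    using S(1) by (intro degree_le) (auto simp: coeffP)
  have "(\<Sum>s\<le>p. coeff P s * of_int (poly L (int s))) \<in> nonunits"
    using T P polyP dL dP root_of_unity_mem root_of_unity_cong_1
    by (intro moments_nonunits[of T]) auto
  also have "(\<Sum>s\<le>p. coeff P s * of_int (poly L (int s))) =
      (\<Sum>s\<in>{s0}. coeff P s * of_int (poly L (int s)))"
  proof (rule sum.mono_neutral_right)
    show "{s0} \<subseteq> {..p}" using s0(1) S(1) by auto
    show "\<forall>s\<in>{..p} - {s0}. coeff P s * of_int (poly L (int s)) = 0"
      using finS by (auto simp: coeffP L_def poly_prod)
  qed simp
  also have "\<dots> = of_int (\<Prod>s\<in>S - {s0}. int s0 - int s)"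
    using s0 by (simp add: coeffP L_def poly_prod)
  finally have "int p dvd (\<Prod>s\<in>S - {s0}. int s0 - int s)"
    by (rule of_int_nonunit_imp_dvd)
  then obtain r where r: "r \<in> S - {s0}" "int p dvd int s0 - int r"
    using p finS by (auto simp: prime_dvd_prod_iff)
  then have "int p \<le> \<bar>int s0 - int r\<bar>"
    by (intro zdvd_imp_le) (auto simp: dvd_imp_le)
  moreover have "s0 < p" "r < p" using S(1) s0(1) r(1) by auto
  ultimately show False by linarith
qed

section \<open>Characters of the cyclic group and signals with few frequencies\<close>

definition character :: "'p::finite mod_ring \<Rightarrow> complex" where
  "character a = omega CARD('p) powi to_int_mod_ring a"

definition rep :: "'p::finite mod_ring \<Rightarrow> nat" where
  "rep a = nat (to_int_mod_ring a)"

lemma to_int_mod_ring_bounds: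
  fixes a :: "'p::finite mod_ring"
  shows "0 \<le> to_int_mod_ring a" "to_int_mod_ring a < int CARD('p)"
  using range_to_int_mod_ring[where ?'a = 'p] by fastforce+

lemma rep_less: "rep (a :: 'p::finite mod_ring) < CARD('p)"
  using to_int_mod_ring_bounds[of a] by (simp add: rep_def nat_less_iff)

lemma of_nat_rep [simp]: "of_nat (rep a) = (a :: 'p::nontriv mod_ring)"
  using to_int_mod_ring_bounds[of a] by (simp add: rep_def of_nat_of_int_mod_ring)

lemma rep_of_nat: "n < CARD('p) \<Longrightarrow> rep (of_nat n :: 'p::nontriv mod_ring) = n"
  by (simp add: rep_def of_nat_of_int_mod_ring)

lemma inj_on_rep: "inj_on (rep :: 'p::nontriv mod_ring \<Rightarrow> nat) A"
  by (metis inj_onI of_nat_rep)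

lemma inj_on_of_nat_mod_ring: "inj_on (of_nat :: nat \<Rightarrow> 'p::nontriv mod_ring) {..<CARD('p)}"
  by (metis inj_onI lessThan_iff rep_of_nat)

lemma omega_power: "omega N ^ m = cis (2 * pi * real m / real N)"
  by (simp add: omega_def cis_conv_exp mult_ac flip: exp_of_nat_mult)

lemma omega_power_N: "omega N ^ N = 1"
  by (cases "N = 0") (simp_all add: omega_power)

lemma character_rep: "character a = omega CARD('p) ^ rep (a :: 'p::finite mod_ring)"
  using to_int_mod_ring_bounds(1)[of a] by (simp add: character_def rep_def power_int_nonneg_exp)

lemma of_nat_eq_imp_omega_power_eq:
  assumes "of_nat m = (of_nat n :: 'p::nontriv mod_ring)"
  shows "omega CARD('p) ^ m = omega CARD('p) ^ n"
proof -
  have "int m mod int CARD('p) = int n mod int CARD('p)"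
    using assms by transfer
  then have "m mod CARD('p) = n mod CARD('p)"
    by (metis of_nat_eq_iff zmod_int)
  moreover have "omega CARD('p) ^ j = omega CARD('p) ^ (j mod CARD('p))" for j
    by (subst mult_div_mod_eq[of "CARD('p)" j, symmetric], subst power_add)
      (simp add: power_mult omega_power_N)
  ultimately show ?thesis by metis
qed

lemma character_of_nat: "character (of_nat n :: 'p::nontriv mod_ring) = omega CARD('p) ^ n"
  unfolding character_rep by (rule of_nat_eq_imp_omega_power_eq[where 'p = 'p]) simp

lemma character_0 [simp]: "character (0 :: 'p::nontriv mod_ring) = 1"
  using character_of_nat[of 0, where 'p = 'p] by simp

lemma character_add: "character (a + b) = character a * character (b :: 'p::nontriv mod_ring)"
  using character_of_nat[of "rep a + rep b", where 'p = 'p]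
  by (simp add: character_rep power_add)

lemma character_mult: "character (a * b) = character b ^ rep (a :: 'p::nontriv mod_ring)"
  using character_of_nat[of "rep a * rep b", where 'p = 'p]
  by (simp add: character_rep mult.commute flip: power_mult)

lemma norm_character [simp]: "cmod (character a) = 1"
  by (simp add: character_rep omega_power)

lemma character_nonzero [simp]: "character a \<noteq> 0"
  using norm_character[of a] by force

lemma character_minus: "character (- a) = cnj (character (a :: 'p::nontriv mod_ring))"
proof -
  have "character (- a) * character a = 1" by (simp flip: character_add)
  moreover have "cnj (character a) * character a = 1"
    using complex_norm_square[of "character a"] by (simp add: mult.commute)
  ultimately show ?thesis by (metis character_nonzero mult_right_cancel)
qed

lemma character_diff: "character (a - b) = character a * cnj (character (b :: 'p::nontriv mod_ring))"
  using character_add[of a "- b"] by (simp add: character_minus)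

lemma character_power_card: "character (a :: 'p::nontriv mod_ring) ^ CARD('p) = 1"
  by (simp add: character_rep mult.commute flip: power_mult) (simp add: power_mult omega_power_N)

lemma inj_character: "inj (character :: 'p::nontriv mod_ring \<Rightarrow> complex)"
proof (rule injI)
  fix a b :: "'p mod_ring"
  have "inj_on (\<lambda>k. cis (2 * pi * real k / real CARD('p))) {..<CARD('p)}"
    using bij_betw_roots_unity[of "CARD('p)"] by (simp add: bij_betw_def)
  moreover assume "character a = character b"
  ultimately have "rep a = rep b"
    by (auto simp: character_rep omega_power rep_less dest: inj_onD)
  then show "a = b" by (metis of_nat_rep)
qed

text \<open>
  The values of the characters are \<open>p\<close>-th roots of unity, and as a function of \<open>t = \<chi>(a)\<close> the
  character with frequency \<open>\<xi>\<close> is the power \<open>t ^ rep \<xi>\<close> with an exponent below \<open>p\<close>.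
\<close>
lemma chebotarev_mod_ring:
  fixes c :: "'p::prime_card mod_ring \<Rightarrow> complex"
  assumes card: "card \<Xi> \<le> card A"
    and zero: "\<And>a. a \<in> A \<Longrightarrow> (\<Sum>\<xi>\<in>\<Xi>. c \<xi> * character (\<xi> * a)) = 0"
    and xi: "\<xi> \<in> \<Xi>"
  shows "c \<xi> = 0"
proof -
  have "c (of_nat (rep \<xi>)) = 0"
  proof (rule chebotarev_roots_of_unity[where p = "CARD('p)" and T = "character ` A" and S = "rep ` \<Xi>"
        and c = "\<lambda>s. c (of_nat s)"])
    show "prime CARD('p)" by (rule prime_card)
    show "rep ` \<Xi> \<subseteq> {..<CARD('p)}" using rep_less by auto
    have "card (character ` A) = card A"
      by (intro card_image inj_on_subset[OF inj_character]) auto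
    then show "card (rep ` \<Xi>) \<le> card (character ` A)"
      using card by (simp add: card_image inj_on_rep)
    fix t assume "t \<in> character ` A"
    then obtain a where a: "a \<in> A" "t = character a" by blast
    then show "t ^ CARD('p) = 1" by (simp add: character_power_card)
    show "(\<Sum>s\<in>rep ` \<Xi>. c (of_nat s) * t ^ s) = 0"
      using zero[OF a(1)] by (simp add: sum.reindex inj_on_rep a(2) character_mult)
  qed (use xi in auto)
  then show ?thesis by simp
qed

text \<open>
  The coefficients are left existential: Chebotarev's theorem makes them unique, so the inversion
  formula of the Fourier transform can be avoided.
\<close>
definition spectrum_in :: "'p::finite mod_ring set \<Rightarrow> 'p signal \<Rightarrow> bool" where
  "spectrum_in \<Xi> u \<longleftrightarrow> (\<exists>e. \<forall>n. u n = (\<Sum>\<xi>\<in>\<Xi>. e \<xi> * character (\<xi> * n)))"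

lemma spectrum_inI:
  fixes u :: "'p::finite signal"
  assumes I: "finite I" "h ` I \<subseteq> \<Xi>"
    and u: "\<And>n. u n = (\<Sum>i\<in>I. f i * character (h i * n))"
  shows "spectrum_in \<Xi> u"
  unfolding spectrum_in_def
proof (intro exI allI)
  fix n
  have "u n = (\<Sum>\<xi>\<in>\<Xi>. \<Sum>i | i \<in> I \<and> h i = \<xi>. f i * character (h i * n))"
    unfolding u using I by (intro sum.group[symmetric]) auto
  also have "\<dots> = (\<Sum>\<xi>\<in>\<Xi>. (\<Sum>i | i \<in> I \<and> h i = \<xi>. f i) * character (\<xi> * n))"
    by (intro sum.cong) (auto simp: sum_distrib_right)
  finally show "u n = \<dots>" .
qed

lemma spectrum_in_mono:
  fixes u :: "'p::finite signal"
  assumes "spectrum_in \<Xi> u" "\<Xi> \<subseteq> \<Xi>'" shows "spectrum_in \<Xi>' u"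
proof -
  obtain e where "\<And>n. u n = (\<Sum>\<xi>\<in>\<Xi>. e \<xi> * character (\<xi> * n))"
    using assms(1) unfolding spectrum_in_def by blast
  then show ?thesis using assms(2) by (intro spectrum_inI[of \<Xi> "\<lambda>\<xi>. \<xi>"]) auto
qed

lemma spectrum_in_diff:
  assumes "spectrum_in \<Xi> u" "spectrum_in \<Xi> v"
  shows "spectrum_in \<Xi> (\<lambda>n. u n - v n)"
proof -
  obtain e f where "\<And>n. u n = (\<Sum>\<xi>\<in>\<Xi>. e \<xi> * character (\<xi> * n))"
    "\<And>n. v n = (\<Sum>\<xi>\<in>\<Xi>. f \<xi> * character (\<xi> * n))"
    using assms unfolding spectrum_in_def by blast
  then have "u n - v n = (\<Sum>\<xi>\<in>\<Xi>. (e \<xi> - f \<xi>) * character (\<xi> * n))" for n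
    by (simp add: left_diff_distrib sum_subtractf)
  then show ?thesis
    unfolding spectrum_in_def by (intro exI[of _ "\<lambda>\<xi>. e \<xi> - f \<xi>"]) simp
qed

lemma spectrum_in_vanishing:
  fixes u :: "'p::prime_card signal"
  assumes "spectrum_in \<Xi> u" "card \<Xi> \<le> card A" "\<And>a. a \<in> A \<Longrightarrow> u a = 0"
  shows "u n = 0"
proof -
  obtain e where e: "\<And>n. u n = (\<Sum>\<xi>\<in>\<Xi>. e \<xi> * character (\<xi> * n))"
    using assms(1) unfolding spectrum_in_def by blast
  have "e \<xi> = 0" if "\<xi> \<in> \<Xi>" for \<xi>
    using chebotarev_mod_ring[OF assms(2) _ that, of e] assms(3) e by metis
  then show ?thesis by (simp add: e)
qed

text \<open>
  The columns of the Fourier matrix are characters up to scaling, with the sign of the frequency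
  reversed.
\<close>
lemma fourier_sparse_imp_spectrum_in:
  fixes x :: "'p::nontriv signal"
  assumes "fourier_sparse k x"
  obtains Z where "card Z \<le> k" "spectrum_in Z x"
proof -
  obtain z where z: "norm0 z \<le> k" "x = (\<lambda>j. \<Sum>n\<in>UNIV. fourier_matrix j n * z n)"
    using assms unfolding fourier_sparse_def by blast
  let ?S = "{n. z n \<noteq> 0}"
  have F: "fourier_matrix j n = character (- n * j) / sqrt (real CARD('p))" for j n :: "'p mod_ring"
  proof -
    have "inverse (character (n * j)) = character (- (n * j))"
      by (simp add: inverse_unique flip: character_add)
    then show ?thesis
      by (simp add: fourier_matrix_def character_def power_int_minus mult.commute)
  qed
  have "x j = (\<Sum>n\<in>?S. z n / sqrt (real CARD('p)) * character (- n * j))" for j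
    unfolding z(2) by (rule sum.mono_neutral_cong_right) (auto simp: F)
  then have "spectrum_in (uminus ` ?S) x"
    by (intro spectrum_inI[where I = ?S and h = uminus and f = "\<lambda>n. z n / sqrt (real CARD('p))"]) auto
  moreover have "card (uminus ` ?S) \<le> k"
    using z(1) card_image_le[of ?S uminus] unfolding norm0_def by simp
  ultimately show thesis using that by blast
qed

definition lag_product :: "'p::finite signal \<Rightarrow> 'p mod_ring \<Rightarrow> 'p signal" where
  "lag_product x d n = cnj (x (n + d)) * x n"

lemma spectrum_in_lag_product:
  fixes x :: "'p::nontriv signal"
  assumes "spectrum_in Z x"
  shows "spectrum_in ((\<lambda>(a, b). a - b) ` (Z \<times> Z)) (lag_product x d)"
proof -
  obtain c where c: "\<And>n. x n = (\<Sum>a\<in>Z. c a * character (a * n))"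
    using assms unfolding spectrum_in_def by blast
  have "lag_product x d n = (\<Sum>(a, b)\<in>Z \<times> Z. c a * cnj (c b) * cnj (character (b * d)) * character ((a - b) * n))"
    for n
    unfolding lag_product_def c cnj_sum sum_product
    by (subst sum.swap, subst sum.cartesian_product)
      (auto simp: character_add character_diff algebra_simps intro!: sum.cong)
  then show ?thesis
    by (intro spectrum_inI[where I = "Z \<times> Z" and h = "\<lambda>(a, b). a - b"
          and f = "\<lambda>(a, b). c a * cnj (c b) * cnj (character (b * d))"])
      (auto simp: case_prod_unfold)
qed

text \<open>
  All the pairs on the diagonal have the same difference 0.
\<close>
lemma card_differences:
  fixes Z :: "'a::ab_group_add set"
  assumes "finite Z"
  shows "card ((\<lambda>(a, b). a - b) ` (Z \<times> Z)) \<le> card Z * (card Z - 1) + 1"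
proof -
  let ?D = "(\<lambda>a. (a, a)) ` Z"
  have sub: "?D \<subseteq> Z \<times> Z" by auto
  have cD: "card ?D = card Z" by (intro card_image inj_onI) auto
  have "(\<lambda>(a, b). a - b) ` (Z \<times> Z) \<subseteq> insert 0 ((\<lambda>(a, b). a - b) ` (Z \<times> Z - ?D))" by force
  then have "card ((\<lambda>(a, b). a - b) ` (Z \<times> Z)) \<le> card (insert 0 ((\<lambda>(a, b). a - b) ` (Z \<times> Z - ?D)))"
    using assms by (intro card_mono) auto
  also have "\<dots> \<le> Suc (card ((\<lambda>(a, b). a - b) ` (Z \<times> Z - ?D)))"
    by (rule card_insert_le_m1) auto
  also have "\<dots> \<le> Suc (card (Z \<times> Z - ?D))"
    using assms by (intro Suc_leI le_imp_less_Suc card_image_le) auto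
  also have "card (Z \<times> Z - ?D) = card Z * (card Z - 1)"
    using sub cD assms by (simp add: card_Diff_subset card_cartesian_product diff_mult_distrib2)
  finally show ?thesis by simp
qed

lemma sum_shift:
  fixes f :: "'p::finite mod_ring \<Rightarrow> 'b::comm_monoid_add"
  shows "(\<Sum>n\<in>UNIV. f (n + d)) = (\<Sum>n\<in>UNIV. f n)"
  by (rule sum.reindex_bij_witness[of _ "\<lambda>n. n - d" "\<lambda>n. n + d"]) auto

section \<open>The measurements as correlations of lag products\<close>

text \<open>
  Up to conventions on signs and conjugation this is the discrete ambiguity function of \<open>g\<close>: the
  Fourier transform of the lag product.
\<close>
definition ambiguity :: "'p::finite signal \<Rightarrow> 'p mod_ring \<Rightarrow> 'p mod_ring \<Rightarrow> complex" where
  "ambiguity g d \<xi> = (\<Sum>m\<in>UNIV. character (\<xi> * m) * cnj (lag_product g d m))"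

text \<open>
  The double sum over pairs of positions \<open>(j, n)\<close> is reordered by the lag \<open>d = j - n\<close>, the only
  quantity through which the modulation parameter \<open>l\<close> enters.
\<close>
lemma spectrogram:
  fixes x g :: "'p::nontriv signal"
  shows "complex_of_real ((cmod (scalar_prod x (gabor g (p, l))))\<^sup>2) =
    (\<Sum>d\<in>UNIV. (\<Sum>n\<in>UNIV. lag_product x d n * cnj (lag_product g d (n - p))) * character (d * l))"
proof -
  let ?s = "scalar_prod x (gabor g (p, l))"
  let ?t = "\<lambda>j n. cnj (x j) * x n * g (j - p) * cnj (g (n - p)) * character (l * (j - n))"
  have s: "?s = (\<Sum>j\<in>UNIV. cnj (x j) * character (l * j) * g (j - p))"
    by (simp add: scalar_prod_def gabor_def modulation_def translation_def character_def mult_ac)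
  have "complex_of_real ((cmod ?s)\<^sup>2) = ?s * cnj ?s"
    by (rule complex_norm_square)
  also have "\<dots> = (\<Sum>j\<in>UNIV. \<Sum>n\<in>UNIV. ?t j n)"
    unfolding s cnj_sum sum_product
    by (intro sum.cong refl) (simp add: character_diff right_diff_distrib mult_ac)
  also have "\<dots> = (\<Sum>n\<in>UNIV. \<Sum>j\<in>UNIV. ?t j n)" by (rule sum.swap)
  also have "\<dots> = (\<Sum>n\<in>UNIV. \<Sum>d\<in>UNIV. ?t (d + n) n)"
    by (intro sum.cong refl sum_shift[symmetric])
  also have "\<dots> = (\<Sum>d\<in>UNIV. \<Sum>n\<in>UNIV. ?t (d + n) n)" by (rule sum.swap)
  also have "\<dots> = (\<Sum>d\<in>UNIV. (\<Sum>n\<in>UNIV. lag_product x d n * cnj (lag_product g d (n - p))) * character (d * l))"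
    unfolding sum_distrib_right
    by (intro sum.cong refl) (simp add: lag_product_def algebra_simps)
  finally show ?thesis .
qed

text \<open>
  Correlation with \<open>w\<close> multiplies the coefficient at each frequency by the Fourier transform of \<open>w\<close>.
  So it does not enlarge the spectrum, and with \<open>w\<close> as assumed it does not lose any frequency.
\<close>
lemma correlation_vanishing_imp_zero:
  fixes u :: "'p::prime_card signal"
  assumes u: "spectrum_in \<Xi> u" and card: "card \<Xi> \<le> card A"
    and zero: "\<And>p. p \<in> A \<Longrightarrow> (\<Sum>n\<in>UNIV. u n * w (n - p)) = 0"
    and w: "\<And>\<xi>. (\<Sum>m\<in>UNIV. character (\<xi> * m) * w m) \<noteq> 0"
  shows "u n = 0"
proof -
  obtain e where e: "\<And>n. u n = (\<Sum>\<xi>\<in>\<Xi>. e \<xi> * character (\<xi> * n))"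
    using u unfolding spectrum_in_def by blast
  let ?W = "\<lambda>\<xi>. \<Sum>m\<in>UNIV. character (\<xi> * m) * w m"
  have conv: "(\<Sum>n\<in>UNIV. u n * w (n - p)) = (\<Sum>\<xi>\<in>\<Xi>. (e \<xi> * ?W \<xi>) * character (\<xi> * p))" for p
  proof -
    have "(\<Sum>n\<in>UNIV. u n * w (n - p)) = (\<Sum>m\<in>UNIV. u (m + p) * w m)"
      using sum_shift[of "\<lambda>n. u n * w (n - p)" p] by simp
    also have "\<dots> = (\<Sum>m\<in>UNIV. \<Sum>\<xi>\<in>\<Xi>. e \<xi> * (character (\<xi> * m) * w m) * character (\<xi> * p))"
      by (simp add: e sum_distrib_right sum_distrib_left distrib_left character_add mult_ac)
    also have "\<dots> = (\<Sum>\<xi>\<in>\<Xi>. (e \<xi> * ?W \<xi>) * character (\<xi> * p))"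
      by (subst sum.swap) (simp add: sum_distrib_right sum_distrib_left)
    finally show ?thesis .
  qed
  have "e \<xi> = 0" if "\<xi> \<in> \<Xi>" for \<xi>
    using chebotarev_mod_ring[OF card _ that, of "\<lambda>\<xi>. e \<xi> * ?W \<xi>"] zero w conv by auto
  then show ?thesis by (simp add: e)
qed

section \<open>Phase propagation and recovery\<close>

text \<open>
  At a point where \<open>x\<close> is not zero, \<open>x = c * y\<close> propagates to the next \<open>k\<close> points.  Among any \<open>k\<close>
  consecutive points there is such a point to continue from, since \<open>x\<close> has at most \<open>k\<close> frequencies.
\<close>
lemma lag_products_determine_signal:
  fixes x y :: "'p::prime_card signal"
  assumes x: "spectrum_in Z x" "card Z \<le> k" "k < CARD('p)"
    and lag: "\<And>d n. d \<le> k \<Longrightarrow> lag_product x (of_nat d) n = lag_product y (of_nat d) n"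
  obtains c where "cmod c = 1" "x = (\<lambda>n. c * y n)"
proof -
  have norm_eq: "cmod (x n) = cmod (y n)" for n
  proof -
    have "x n * cnj (x n) = y n * cnj (y n)"
      using lag[of 0 n] by (simp add: lag_product_def mult.commute)
    then have "(cmod (x n))\<^sup>2 = (cmod (y n))\<^sup>2"
      unfolding complex_norm_square[symmetric] by (simp only: of_real_eq_iff)
    then show ?thesis by simp
  qed
  show thesis
  proof (cases "\<forall>n. x n = 0")
    case True
    then have "x = (\<lambda>n. 1 * y n)" using norm_eq by (auto simp: fun_eq_iff)
    then show thesis using that[of 1] by simp
  next
    case False
    then obtain n0 where n0: "x n0 \<noteq> 0" by blast
    then have y0: "y n0 \<noteq> 0" using norm_eq[of n0] by auto
    define c where "c = x n0 / y n0"
    have c: "cmod c = 1" using y0 by (simp add: c_def norm_divide norm_eq)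
    \<comment> \<open>The lag product at lag \<open>d\<close> fixes \<open>x (n + d)\<close> once \<open>x n\<close> is known and not zero.\<close>
    have step: "x (n + of_nat d) = c * y (n + of_nat d)"
      if xn: "x n = c * y n" "x n \<noteq> 0" and d: "d \<le> k" for n d
    proof -
      have "cnj (x (n + of_nat d)) * (c * y n) = cnj (y (n + of_nat d)) * y n"
        using lag[OF d, of n] xn(1) by (simp add: lag_product_def)
      then have "cnj (x (n + of_nat d)) * c = cnj (y (n + of_nat d))"
        using xn by auto
      then have "cnj (cnj (x (n + of_nat d)) * c) = y (n + of_nat d)" by simp
      then have "c * y (n + of_nat d) = x (n + of_nat d) * (c * cnj c)" by (auto simp: mult_ac)
      also have "c * cnj c = 1" using c complex_norm_square[of c] by simp
      finally show ?thesis by simp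
    qed
    \<comment> \<open>A zero of \<open>x\<close> at \<open>k\<close> consecutive points would force \<open>x = 0\<close> by Chebotarev's theorem.\<close>
    have nonvanishing: "\<exists>i\<in>{j..<j + k}. x (n0 + of_nat i) \<noteq> 0" for j
    proof (rule ccontr)
      assume "\<not> ?thesis"
      then have zero: "\<And>a. a \<in> (\<lambda>i. n0 + of_nat j + of_nat i) ` {..<k} \<Longrightarrow> x a = 0"
        by (force simp: add.assoc simp flip: of_nat_add)
      have "inj_on (\<lambda>i. n0 + of_nat j + of_nat i) {..<k}"
        using inj_on_subset[OF inj_on_of_nat_mod_ring[where 'p = 'p], of "{..<k}"] x(3)
        by (auto simp: inj_on_def)
      then have "card Z \<le> card ((\<lambda>i. n0 + of_nat j + of_nat i) ` {..<k})"
        using x(2) by (simp add: card_image)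
      from spectrum_in_vanishing[OF x(1) this zero] n0 show False by blast
    qed
    have "x (n0 + of_nat j) = c * y (n0 + of_nat j)" for j
    proof (induction j rule: less_induct)
      case (less j)
      show ?case
      proof (cases "j \<le> k")
        case True
        then show ?thesis using step[of n0 j] y0 n0 by (simp add: c_def)
      next
        case False
        obtain i where i: "i \<in> {j - k..<j - k + k}" "x (n0 + of_nat i) \<noteq> 0"
          using nonvanishing by blast
        have "x (n0 + of_nat i + of_nat (j - i)) = c * y (n0 + of_nat i + of_nat (j - i))"
          by (rule step) (use i False less.IH in auto)
        moreover have "n0 + of_nat i + of_nat (j - i) = n0 + (of_nat j :: 'p mod_ring)"
          using i False by (simp add: of_nat_diff)
        ultimately show ?thesis by simp
      qed
    qed
    then have "x n = c * y n" for n
      by (metis of_nat_rep add_diff_cancel_left' add.commute diff_add_cancel)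
    then show thesis using that c by blast
  qed
qed

definition short_lags :: "nat \<Rightarrow> 'p::nontriv mod_ring set" where
  "short_lags k = of_int ` {- int k..int k}"

lemma card_short_lags: "card (short_lags k) \<le> 2 * k + 1"
  unfolding short_lags_def by (rule order.trans[OF card_image_le]) auto

lemma lag_product_zero_outside_short_lags:
  assumes supp: "{n. g n \<noteq> 0} \<subseteq> of_nat ` {0..k}" and d: "d \<notin> short_lags k"
  shows "lag_product g d n = 0"
proof (rule ccontr)
  assume "lag_product g d n \<noteq> 0"
  then have "n + d \<in> of_nat ` {0..k}" "n \<in> of_nat ` {0..k}"
    using supp by (auto simp: lag_product_def)
  then obtain i j where ij: "n + d = of_nat i" "n = of_nat j" "i \<le> k" "j \<le> k" by auto
  then have "d = of_int (int i - int j)" by (metis add_diff_cancel_left' of_int_diff of_int_of_nat_eq)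
  then have "d \<in> short_lags k" unfolding short_lags_def using ij by (intro image_eqI[of _ _ "int i - int j"]) auto
  then show False using d by simp
qed

text \<open>
  The set \<open>B\<close> separates the lags and the set \<open>A\<close> removes the window, so the lag products of the signals
  are determined by the measurements.  The number of frequencies that \<open>A\<close> has to handle is at most
  \<open>4k\<^sup>2 - 2k + 1\<close>, and trivially at most \<open>N\<close>, which accounts for the minimum.
\<close>
lemma phase_retrieval_if_ambiguity_nonzero:
  fixes g :: "'p::prime_card signal"
  assumes k: "k < CARD('p)"
    and supp: "{n. g n \<noteq> 0} \<subseteq> of_nat ` {0..k}"
    and amb: "\<And>d \<xi>. d \<le> k \<Longrightarrow> ambiguity g (of_nat d) \<xi> \<noteq> 0"
    and A: "card A = min (4 * k ^ 2 - 2 * k + 1) CARD('p)"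
    and B: "card B = 2 * k + 1"
  shows "allows_fourier_sparse_phase_retrieval k (A \<times> B) (gabor g)"
  unfolding allows_fourier_sparse_phase_retrieval_def
proof (intro allI impI, elim conjE)
  fix x y :: "'p signal"
  assume "fourier_sparse k x" "fourier_sparse k y"
    and meas: "\<forall>i\<in>A \<times> B. cmod (scalar_prod x (gabor g i)) = cmod (scalar_prod y (gabor g i))"
  then obtain X Y where X: "card X \<le> k" "spectrum_in X x" and Y: "card Y \<le> k" "spectrum_in Y y"
    using fourier_sparse_imp_spectrum_in by metis
  define \<Delta> where "\<Delta> d n = lag_product x d n - lag_product y d n" for d n
  \<comment> \<open>For fixed \<open>p\<close> the difference of the two squared measurements is a combination of at most
  \<open>2 * k + 1\<close> characters in \<open>l\<close> that vanishes on \<open>B\<close>.\<close>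
  have corr: "(\<Sum>n\<in>UNIV. \<Delta> d n * cnj (lag_product g d (n - p))) = 0"
    if p: "p \<in> A" and d: "d \<in> short_lags k" for p d
  proof (rule chebotarev_mod_ring[where \<Xi> = "short_lags k" and A = B
        and c = "\<lambda>d. \<Sum>n\<in>UNIV. \<Delta> d n * cnj (lag_product g d (n - p))"])
    show "card (short_lags k) \<le> card B" using card_short_lags B by metis
    fix l assume "l \<in> B"
    then have "complex_of_real ((cmod (scalar_prod x (gabor g (p, l))))\<^sup>2)
        - complex_of_real ((cmod (scalar_prod y (gabor g (p, l))))\<^sup>2) = 0"
      using meas p by simp
    then have "(\<Sum>d\<in>UNIV. (\<Sum>n\<in>UNIV. \<Delta> d n * cnj (lag_product g d (n - p))) * character (d * l)) = 0"
      unfolding spectrogram \<Delta>_def by (simp add: sum_subtractf left_diff_distrib)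
    moreover have "(\<Sum>d\<in>UNIV. (\<Sum>n\<in>UNIV. \<Delta> d n * cnj (lag_product g d (n - p))) * character (d * l)) =
        (\<Sum>d\<in>short_lags k. (\<Sum>n\<in>UNIV. \<Delta> d n * cnj (lag_product g d (n - p))) * character (d * l))"
      by (rule sum.mono_neutral_right) (auto simp: lag_product_zero_outside_short_lags[OF supp])
    ultimately show "(\<Sum>d\<in>short_lags k. (\<Sum>n\<in>UNIV. \<Delta> d n * cnj (lag_product g d (n - p))) * character (d * l)) = 0"
      by simp
  qed (rule d)
  let ?Z = "X \<union> Y"
  let ?\<Xi> = "(\<lambda>(a, b). a - b) ` (?Z \<times> ?Z)"
  have spec: "spectrum_in ?\<Xi> (\<Delta> d)" for d
    unfolding \<Delta>_def using X(2) Y(2)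
    by (intro spectrum_in_diff spectrum_in_lag_product) (auto intro: spectrum_in_mono)
  have "card ?Z \<le> 2 * k" using card_Un_le[of X Y] X(1) Y(1) by simp
  then have "card ?Z * (card ?Z - 1) + 1 \<le> 2 * k * (2 * k - 1) + 1"
    by (intro add_mono mult_mono) auto
  also have "2 * k * (2 * k - 1) + 1 = 4 * k ^ 2 - 2 * k + 1"
    by (simp add: power2_eq_square diff_mult_distrib2)
  finally have "card ?\<Xi> \<le> 4 * k ^ 2 - 2 * k + 1"
    using card_differences[of ?Z] by simp
  moreover have "card ?\<Xi> \<le> CARD('p)"
    using card_mono[of UNIV ?\<Xi>] by simp
  ultimately have card: "card ?\<Xi> \<le> card A" using A by simp
  have "lag_product x (of_nat d) n = lag_product y (of_nat d) n" if "d \<le> k" for d n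
  proof -
    have "of_nat d \<in> (short_lags k :: 'p mod_ring set)"
      unfolding short_lags_def using that by (intro image_eqI[of _ _ "int d"]) auto
    then have "\<Delta> (of_nat d) n = 0"
      using corr amb[OF that, unfolded ambiguity_def]
      by (intro correlation_vanishing_imp_zero[OF spec card, where w = "\<lambda>m. cnj (lag_product g (of_nat d) m)"])
    then show ?thesis by (simp add: \<Delta>_def)
  qed
  then show "\<exists>c. cmod c = 1 \<and> x = (\<lambda>n. c * y n)"
    using lag_products_determine_signal[OF X(2,1) k, of y] by metis
qed

section \<open>Polynomial dependence on the window\<close>

definition monomial_eval :: "(nat \<Rightarrow>\<^sub>0 nat) \<Rightarrow> (nat \<Rightarrow> real) \<Rightarrow> real" where
  "monomial_eval m v = (\<Prod>i\<in>Poly_Mapping.keys m. v i ^ Poly_Mapping.lookup m i)"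

lemma monomial_eval_superset:
  "finite I \<Longrightarrow> Poly_Mapping.keys m \<subseteq> I \<Longrightarrow> monomial_eval m v = (\<Prod>i\<in>I. v i ^ Poly_Mapping.lookup m i)"
  unfolding monomial_eval_def by (rule prod.mono_neutral_left) (auto simp: in_keys_iff)

lemma monomial_eval_add: "monomial_eval (m + n) v = monomial_eval m v * monomial_eval n v"
proof -
  let ?I = "Poly_Mapping.keys m \<union> Poly_Mapping.keys n"
  have "monomial_eval (m + n) v = (\<Prod>i\<in>?I. v i ^ Poly_Mapping.lookup (m + n) i)"
    by (rule monomial_eval_superset) (auto dest: subsetD[OF keys_add])
  also have "\<dots> = (\<Prod>i\<in>?I. v i ^ Poly_Mapping.lookup m i) * (\<Prod>i\<in>?I. v i ^ Poly_Mapping.lookup n i)"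
    by (simp add: lookup_add power_add prod.distrib)
  also have "\<dots> = monomial_eval m v * monomial_eval n v"
    by (simp add: monomial_eval_superset[of ?I])
  finally show ?thesis .
qed

lemma mpoly_eval_superset:
  "finite M \<Longrightarrow> Poly_Mapping.keys P \<subseteq> M \<Longrightarrow> mpoly_eval P v = (\<Sum>m\<in>M. Poly_Mapping.lookup P m * monomial_eval m v)"
  unfolding mpoly_eval_def monomial_eval_def[symmetric]
  by (rule sum.mono_neutral_left) (auto simp: in_keys_iff)

lemma mpoly_eval_single: "mpoly_eval (Poly_Mapping.single m c) v = c * monomial_eval m v"
  by (subst mpoly_eval_superset[of "{m}"]) auto

lemma mpoly_eval_add: "mpoly_eval (P + Q) v = mpoly_eval P v + mpoly_eval Q v"
proof -
  let ?M = "Poly_Mapping.keys P \<union> Poly_Mapping.keys Q"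
  have "mpoly_eval (P + Q) v = (\<Sum>m\<in>?M. Poly_Mapping.lookup (P + Q) m * monomial_eval m v)"
    by (rule mpoly_eval_superset) (auto dest: subsetD[OF keys_add])
  then show ?thesis
    by (simp add: lookup_add distrib_right sum.distrib mpoly_eval_superset[of ?M])
qed

lemma poly_mapping_induct_single [case_names single add]:
  fixes f :: "'a \<Rightarrow>\<^sub>0 'b::comm_monoid_add"
  assumes single: "\<And>k c. P (Poly_Mapping.single k c)"
    and add: "\<And>f g. P f \<Longrightarrow> P g \<Longrightarrow> P (f + g)"
  shows "P f"
proof (induction f rule: update_induct)
  case const
  show ?case using single[of undefined 0] by simp
next
  case (update f a b)
  then have "Poly_Mapping.update a b f = f + Poly_Mapping.single a b"
    by (intro poly_mapping_eqI) (auto simp: lookup_update lookup_add lookup_single in_keys_iff)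
  then show ?case using add single update by metis
qed

lemma mpoly_eval_mult: "mpoly_eval (P * Q) v = mpoly_eval P v * mpoly_eval Q v"
proof (induction P rule: poly_mapping_induct_single)
  case (single m a)
  show ?case
    by (induction Q rule: poly_mapping_induct_single)
      (simp_all add: mult_single mpoly_eval_single monomial_eval_add mpoly_eval_add distrib_left)
qed (simp add: mpoly_eval_add distrib_right)

lemma mpoly_vars_add: "mpoly_vars (P + Q) \<subseteq> mpoly_vars P \<union> mpoly_vars Q"
  using keys_add[of P Q] unfolding mpoly_vars_def by auto

lemma mpoly_vars_mult: "mpoly_vars (P * Q) \<subseteq> mpoly_vars P \<union> mpoly_vars Q"
proof
  fix i assume "i \<in> mpoly_vars (P * Q)"
  then obtain m where "m \<in> Poly_Mapping.keys (P * Q)" "i \<in> Poly_Mapping.keys m"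
    unfolding mpoly_vars_def by blast
  then obtain a b where "a \<in> Poly_Mapping.keys P" "b \<in> Poly_Mapping.keys Q"
      "i \<in> Poly_Mapping.keys (a + b)"
    using keys_mult[of P Q] by blast
  then show "i \<in> mpoly_vars P \<union> mpoly_vars Q"
    using keys_add[of a b] unfolding mpoly_vars_def by blast
qed

text \<open>
  Genericity asks for a formal polynomial, but all that matters about it are its values.  Closure
  under sums and products at the level of functions spares the construction of the polynomial.
\<close>
definition polynomial_map :: "nat set \<Rightarrow> ((nat \<Rightarrow> real) \<Rightarrow> real) \<Rightarrow> bool" where
  "polynomial_map V f \<longleftrightarrow> (\<exists>P. mpoly_vars P \<subseteq> V \<and> (\<forall>v. mpoly_eval P v = f v))"

lemma polynomial_map_const: "polynomial_map V (\<lambda>v. c)"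
  unfolding polynomial_map_def
  by (intro exI[of _ "Poly_Mapping.single 0 c"])
    (auto simp: mpoly_vars_def mpoly_eval_single monomial_eval_def split: if_splits)

lemma polynomial_map_var: "i \<in> V \<Longrightarrow> polynomial_map V (\<lambda>v. v i)"
  unfolding polynomial_map_def
  by (intro exI[of _ "Poly_Mapping.single (Poly_Mapping.single i 1) 1"])
    (auto simp: mpoly_vars_def mpoly_eval_single monomial_eval_def split: if_splits)

lemma polynomial_map_add:
  "polynomial_map V f \<Longrightarrow> polynomial_map V g \<Longrightarrow> polynomial_map V (\<lambda>v. f v + g v)"
  unfolding polynomial_map_def using mpoly_vars_add mpoly_eval_add by (metis Un_subset_iff dual_order.trans)

lemma polynomial_map_mult:
  "polynomial_map V f \<Longrightarrow> polynomial_map V g \<Longrightarrow> polynomial_map V (\<lambda>v. f v * g v)"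
  unfolding polynomial_map_def using mpoly_vars_mult mpoly_eval_mult by (metis Un_subset_iff dual_order.trans)

lemma polynomial_map_uminus: "polynomial_map V f \<Longrightarrow> polynomial_map V (\<lambda>v. - f v)"
  using polynomial_map_mult[OF polynomial_map_const[of V "- 1"]] by simp

lemma polynomial_map_sum:
  "(\<And>i. i \<in> I \<Longrightarrow> polynomial_map V (f i)) \<Longrightarrow> polynomial_map V (\<lambda>v. \<Sum>i\<in>I. f i v)"
  by (induction I rule: infinite_finite_induct) (auto intro: polynomial_map_const polynomial_map_add)

lemma polynomial_map_prod:
  "(\<And>i. i \<in> I \<Longrightarrow> polynomial_map V (f i)) \<Longrightarrow> polynomial_map V (\<lambda>v. \<Prod>i\<in>I. f i v)"
  by (induction I rule: infinite_finite_induct) (auto intro: polynomial_map_const polynomial_map_mult)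

definition complex_polynomial_map :: "nat set \<Rightarrow> ((nat \<Rightarrow> real) \<Rightarrow> complex) \<Rightarrow> bool" where
  "complex_polynomial_map V f \<longleftrightarrow> polynomial_map V (\<lambda>v. Re (f v)) \<and> polynomial_map V (\<lambda>v. Im (f v))"

lemma complex_polynomial_map_const: "complex_polynomial_map V (\<lambda>v. c)"
  by (simp add: complex_polynomial_map_def polynomial_map_const)

lemma complex_polynomial_map_cnj:
  "complex_polynomial_map V f \<Longrightarrow> complex_polynomial_map V (\<lambda>v. cnj (f v))"
  by (simp add: complex_polynomial_map_def polynomial_map_uminus)

lemma complex_polynomial_map_mult:
  assumes "complex_polynomial_map V f" "complex_polynomial_map V g"
  shows "complex_polynomial_map V (\<lambda>v. f v * g v)"
  using assms unfolding complex_polynomial_map_def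
  by (auto simp only: times_complex.sel diff_conv_add_uminus
      intro!: polynomial_map_add polynomial_map_uminus polynomial_map_mult)

lemma complex_polynomial_map_sum:
  "(\<And>i. i \<in> I \<Longrightarrow> complex_polynomial_map V (f i)) \<Longrightarrow> complex_polynomial_map V (\<lambda>v. \<Sum>i\<in>I. f i v)"
  by (simp add: complex_polynomial_map_def polynomial_map_sum)

lemma polynomial_map_cmod_power2:
  "complex_polynomial_map V f \<Longrightarrow> polynomial_map V (\<lambda>v. (cmod (f v))\<^sup>2)"
  unfolding complex_polynomial_map_def cmod_power2
  by (auto simp: power2_eq_square intro!: polynomial_map_add polynomial_map_mult)

text \<open>
  A left inverse of \<open>window_coords\<close> on the windows supported in \<open>{0..k}\<close>.  It makes every quantity built
  from such a window a function of the real coordinates.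
\<close>
definition window_of :: "nat \<Rightarrow> (nat \<Rightarrow> real) \<Rightarrow> 'p::finite signal" where
  "window_of k v n = (if rep n \<le> k then Complex (v (2 * rep n)) (v (2 * rep n + 1)) else 0)"

lemma window_of_window_coords:
  fixes g :: "'p::nontriv signal"
  assumes "{n. g n \<noteq> 0} \<subseteq> of_nat ` {0..k}" "k < CARD('p)"
  shows "window_of k (window_coords g) = g"
proof
  fix n
  show "window_of k (window_coords g) n = g n"
  proof (cases "rep n \<le> k")
    case True
    then show ?thesis by (simp add: window_of_def window_coords_def)
  next
    case False
    have "g n = 0"
    proof (rule ccontr)
      assume "g n \<noteq> 0"
      then obtain i where "i \<le> k" "n = of_nat i" using assms(1) by auto
      then show False using False assms(2) by (simp add: rep_of_nat)
    qed
    then show ?thesis using False by (simp add: window_of_def)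
  qed
qed

lemma complex_polynomial_map_window_of:
  "complex_polynomial_map {..<2 * (k + 1)} (\<lambda>v. window_of k v n)"
  unfolding complex_polynomial_map_def window_of_def
  by (cases "rep n \<le> k") (auto intro!: polynomial_map_var polynomial_map_const)

lemma complex_polynomial_map_ambiguity:
  "complex_polynomial_map {..<2 * (k + 1)} (\<lambda>v. ambiguity (window_of k v) d \<xi>)"
  unfolding ambiguity_def lag_product_def
  by (intro complex_polynomial_map_sum complex_polynomial_map_mult complex_polynomial_map_const
      complex_polynomial_map_cnj complex_polynomial_map_window_of)

lemma geometric_sum_nonzero:
  fixes z :: complex
  assumes "cmod z > 1" shows "(\<Sum>j<Suc n. z ^ j) \<noteq> 0"
proof
  assume "(\<Sum>j<Suc n. z ^ j) = 0"
  then have "z ^ Suc n = 1" using one_diff_power_eq[of z "Suc n"] by simp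
  then have "cmod z ^ Suc n = 1" by (metis norm_one norm_power)
  then show False using one_less_power[OF assms, of "Suc n"] by simp
qed

text \<open>
  For \<open>g(m) = 2\<^sup>m\<close> on \<open>{0, \<dots>, k}\<close> the summand at \<open>m = j\<close> is \<open>2\<^sup>d * (4 * \<chi>(\<xi>))\<^sup>j\<close> for \<open>j \<le> k - d\<close>, and all
  others vanish.  There is no wrap-around, because \<open>j + d \<le> 2k < N\<close> for \<open>j \<le> k\<close>.
\<close>
lemma exponential_window_ambiguity_nonzero:
  fixes \<xi> :: "'p::nontriv mod_ring"
  assumes k: "2 * k + 1 < CARD('p)" and d: "d \<le> k"
  defines "v \<equiv> \<lambda>i. if even i then 2 ^ (i div 2) else 0"
  shows "ambiguity (window_of k v) (of_nat d) \<xi> \<noteq> 0"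
proof -
  let ?g = "window_of k v :: 'p signal"
  let ?z = "4 * character \<xi>"
  have g: "?g n = (if rep n \<le> k then 2 ^ rep n else 0)" for n
    by (simp add: window_of_def v_def Complex_eq)
  have rep_add: "rep (n + of_nat d) = rep n + d" if "rep n \<le> k" for n :: "'p mod_ring"
    using rep_of_nat[of "rep n + d", where 'p = 'p] that k d by simp
  let ?J = "{..<Suc (k - d)}"
  have inj: "inj_on (of_nat :: nat \<Rightarrow> 'p mod_ring) ?J"
    using k by (intro inj_on_subset[OF inj_on_of_nat_mod_ring]) auto
  have "ambiguity ?g (of_nat d) \<xi> =
      (\<Sum>m\<in>of_nat ` ?J. character (\<xi> * m) * cnj (lag_product ?g (of_nat d) m))"
    unfolding ambiguity_def
  proof (rule sum.mono_neutral_right)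
    show "\<forall>m\<in>UNIV - of_nat ` ?J. character (\<xi> * m) * cnj (lag_product ?g (of_nat d) m) = 0"
    proof
      fix m :: "'p mod_ring" assume "m \<in> UNIV - of_nat ` ?J"
      then have "rep m \<notin> ?J" by (metis DiffD2 image_eqI of_nat_rep)
      then have "\<not> rep m + d \<le> k" by auto
      then show "character (\<xi> * m) * cnj (lag_product ?g (of_nat d) m) = 0"
        using rep_add[of m] by (auto simp: lag_product_def g)
    qed
  qed auto
  also have "\<dots> = (\<Sum>j\<in>?J. character (\<xi> * of_nat j) * cnj (lag_product ?g (of_nat d) (of_nat j)))"
    by (simp only: sum.reindex[OF inj] o_def)
  also have "\<dots> = (\<Sum>j\<in>?J. 2 ^ d * ?z ^ j)"
  proof (rule sum.cong[OF refl])
    fix j assume j: "j \<in> ?J"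
    have r: "rep (of_nat j :: 'p mod_ring) = j" using j k by (intro rep_of_nat) auto
    have "character (\<xi> * of_nat j) = character \<xi> ^ j"
      using character_mult[of "of_nat j" \<xi>] r by (simp add: mult.commute)
    moreover have "rep (of_nat j + of_nat d :: 'p mod_ring) = j + d"
      using rep_add[of "of_nat j"] r j d by auto
    ultimately show "character (\<xi> * of_nat j) * cnj (lag_product ?g (of_nat d) (of_nat j)) = 2 ^ d * ?z ^ j"
      using j d r by (simp add: lag_product_def g power_add power_mult_distrib flip: power_mult_distrib[of 2 2])
  qed
  also have "\<dots> = 2 ^ d * (\<Sum>j\<in>?J. ?z ^ j)" by (simp only: sum_distrib_left)
  also have "\<dots> \<noteq> 0" using geometric_sum_nonzero[of ?z "k - d"] by (simp add: norm_mult)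
  finally show ?thesis .
qed

theorem proposition3p2:
  fixes N k :: nat
  assumes "N = CARD('p::prime_card)"
    and "k > 0"
    and "2 * k + 1 < N"
  shows "for_generic_window k (\<lambda>g :: 'p signal.
           \<forall>A B :: 'p mod_ring set.
             card A = min (4 * k ^ 2 - 2 * k + 1) N \<and> card B = 2 * k + 1 \<longrightarrow>
             allows_fourier_sparse_phase_retrieval k (A \<times> B) (gabor g))"
proof -
  define f :: "(nat \<Rightarrow> real) \<Rightarrow> real" where
    "f v = (\<Prod>d\<le>k. \<Prod>\<xi>\<in>UNIV. (cmod (ambiguity (window_of k v :: 'p signal) (of_nat d) \<xi>))\<^sup>2)" for v
  have "polynomial_map {..<2 * (k + 1)} f"
    unfolding f_def
    by (intro polynomial_map_prod polynomial_map_cmod_power2 complex_polynomial_map_ambiguity)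
  then obtain P where P: "mpoly_vars P \<subseteq> {..<2 * (k + 1)}" "\<And>v. mpoly_eval P v = f v"
    unfolding polynomial_map_def by blast
  have "f (\<lambda>i. if even i then 2 ^ (i div 2) else 0) \<noteq> 0"
    unfolding f_def using exponential_window_ambiguity_nonzero[where 'p = 'p, of k] assms by auto
  then have "P \<noteq> 0" using P(2) by (auto simp: mpoly_eval_def)
  moreover have "allows_fourier_sparse_phase_retrieval k (A \<times> B) (gabor g)"
    if supp: "{n. g n \<noteq> 0} \<subseteq> of_nat ` {0..k}" and nz: "mpoly_eval P (window_coords g) \<noteq> 0"
      and AB: "card A = min (4 * k ^ 2 - 2 * k + 1) N" "card B = 2 * k + 1"
    for g :: "'p signal" and A B
  proof (rule phase_retrieval_if_ambiguity_nonzero[OF _ supp])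
    show k: "k < CARD('p)" using assms by simp
    show "ambiguity g (of_nat d) \<xi> \<noteq> 0" if "d \<le> k" for d \<xi>
      using nz that unfolding P(2) f_def window_of_window_coords[OF supp k] by auto
  qed (use AB assms(1) in auto)
  ultimately show ?thesis
    unfolding for_generic_window_def using P(1) by blast
qed

end
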